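(* For $n\ge 1$ let $M_{2n}$ be the matching graph on $2n$ vertices (the disjoint union of $n$ edges). Then $\mathrm{USN}(M_{2n}) = O(\log_2 (2n))$ as $n\to\infty$; that is, there exist constants $C>0$ and $n_0$ such that $\mathrm{USN}(M_{2n})\le C\log_2(2n)$ for all $n\ge n_0$.
   Context: Graphs are finite, simple and undirected. A valid labelling of a graph $G$ with universe a finite set $S$ assigns to the vertices of $G$ pairwise distinct nonempty subsets of $S$ such that two distinct vertices are adjacent if and only if their labels are disjoint. The universe size number $\mathrm{USN}(G)$ is the minimum of $|S|$ over all finite sets $S$ for which $G$ has a valid labelling with universe $S$. *)

theory Defs
  imports Complex_Main "Graph_Theory.Pair_Digraph"
begin

text \<open>
  Finite simple undirected graphs are rendered by the locale \<^locale>\<open>pair_graph\<close>: an undirected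
  edge \<open>uv\<close> is the pair of arcs \<open>(u, v)\<close> and \<open>(v, u)\<close>.
\<close>

definition valid_labelling :: "'a pair_pre_digraph \<Rightarrow> 's set \<Rightarrow> ('a \<Rightarrow> 's set) \<Rightarrow> bool" where
  "valid_labelling G S f \<longleftrightarrow>
     finite S \<and>
     (\<forall>v\<in>pverts G. f v \<noteq> {} \<and> f v \<subseteq> S) \<and>
     inj_on f (pverts G) \<and>
     (\<forall>u\<in>pverts G. \<forall>v\<in>pverts G. u \<noteq> v \<longrightarrow> ((u, v) \<in> parcs G \<longleftrightarrow> f u \<inter> f v = {}))"

text \<open>
  A type cannot be quantified inside a definition, so universes are taken to be sets of natural
  numbers. Lemma \<open>USN_le_card\<close> shows that universes of any other type give nothing smaller, and
  \<open>USN_attained\<close> that the minimum exists for every finite simple graph.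
\<close>

definition USN :: "'a pair_pre_digraph \<Rightarrow> nat" where
  "USN G = (LEAST k. \<exists>(S :: nat set) f. valid_labelling G S f \<and> card S = k)"

definition matching_graph :: "nat \<Rightarrow> (nat \<times> bool) pair_pre_digraph" where
  "matching_graph n =
     \<lparr> pverts = {..<n} \<times> UNIV, parcs = {((i, b), (i, \<not> b)) | i b. i < n} \<rparr>"

lemma pair_graph_matching_graph: "pair_graph (matching_graph n)"
proof -
  have "parcs (matching_graph n) \<subseteq> pverts (matching_graph n) \<times> pverts (matching_graph n)"
    and fin: "finite (pverts (matching_graph n))"
    by (auto simp: matching_graph_def)
  then have "finite (parcs (matching_graph n))"
    by (meson finite_SigmaI finite_subset)
  with fin show ?thesis
    by unfold_locales (auto simp: matching_graph_def symmetric_def intro!: symI)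
qed

lemma card_pverts_matching_graph: "card (pverts (matching_graph n)) = 2 * n"
  by (simp add: matching_graph_def card_cartesian_product)

lemma valid_labelling_image:
  assumes "valid_labelling G S f" and "inj_on h S"
  shows "valid_labelling G (h ` S) (\<lambda>v. h ` f v)"
proof -
  have sub: "f v \<subseteq> S" if "v \<in> pverts G" for v
    using assms(1) that by (simp add: valid_labelling_def)
  have eq: "h ` f u = h ` f v \<longleftrightarrow> f u = f v" if "u \<in> pverts G" "v \<in> pverts G" for u v
    using inj_on_image_eq_iff[OF assms(2)] sub that by simp
  have int: "h ` f u \<inter> h ` f v = h ` (f u \<inter> f v)" if "u \<in> pverts G" "v \<in> pverts G" for u v
    using inj_on_image_Int[OF assms(2)] sub that by simp
  have "inj_on (\<lambda>v. h ` f v) (pverts G)"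
    using assms(1) eq by (simp add: valid_labelling_def inj_on_def)
  then show ?thesis
    using assms(1) by (auto simp: valid_labelling_def int simp del: image_Int)
qed

lemma valid_labelling_nat_universe:
  assumes "valid_labelling G S f"
  shows "\<exists>(T :: nat set) g. valid_labelling G T g \<and> card T = card S"
proof -
  have "finite S" using assms by (simp add: valid_labelling_def)
  then obtain h :: "_ \<Rightarrow> nat" where "inj_on h S"
    using finite_imp_inj_to_nat_seg by metis
  then show ?thesis
    using valid_labelling_image[OF assms] card_image by blast
qed

lemma USN_le_card:
  assumes "valid_labelling G S f"
  shows "USN G \<le> card S"
  unfolding USN_def using valid_labelling_nat_universe[OF assms] by (rule Least_le)

lemma valid_labelling_exists:
  assumes "pair_graph G"
  shows "valid_labelling G (Pow (pverts G)) (\<lambda>v. {{v, w} | w. w \<in> pverts G \<and> (v, w) \<notin> parcs G})"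
    (is "valid_labelling G _ ?f")
proof -
  interpret pair_graph G by (rule assms)
  have self: "{v} \<in> ?f v" if "v \<in> pverts G" for v
    using that pair_no_loops[of "(v, v)"] by auto
  have symm: "(u, v) \<in> parcs G \<longleftrightarrow> (v, u) \<in> parcs G" for u v
    using pair_sym_arcs by (auto simp: symmetric_def dest: symD)
  have inj: "inj_on ?f (pverts G)"
  proof (rule inj_onI)
    fix u v assume "u \<in> pverts G" "v \<in> pverts G" and eq: "?f u = ?f v"
    then have "{u} \<in> ?f v" using self by blast
    then show "u = v" by (auto simp: doubleton_eq_iff)
  qed
  have adj: "(u, v) \<in> parcs G \<longleftrightarrow> ?f u \<inter> ?f v = {}"
    if uv: "u \<in> pverts G" "v \<in> pverts G" "u \<noteq> v" for u v
  proof
    assume "(u, v) \<in> parcs G"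
    with symm have "(v, u) \<in> parcs G" by simp
    with \<open>(u, v) \<in> parcs G\<close> \<open>u \<noteq> v\<close> show "?f u \<inter> ?f v = {}"
      by (auto simp: doubleton_eq_iff)
  next
    assume disj: "?f u \<inter> ?f v = {}"
    show "(u, v) \<in> parcs G"
    proof (rule ccontr)
      assume "(u, v) \<notin> parcs G"
      moreover from this have "(v, u) \<notin> parcs G" using symm by simp
      moreover have "{u, v} = {v, u}" by auto
      ultimately have "{u, v} \<in> ?f u \<inter> ?f v" using uv by blast
      with disj show False by blast
    qed
  qed
  have ne: "?f v \<noteq> {}" if "v \<in> pverts G" for v
    using self[OF that] by blast
  have sub: "?f v \<subseteq> Pow (pverts G)" if "v \<in> pverts G" for v
    using that by auto
  show ?thesis
    unfolding valid_labelling_def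
    using inj adj ne sub pair_finite_verts by (intro conjI ballI impI) simp_all
qed

lemma USN_attained:
  assumes "pair_graph G"
  shows "\<exists>(S :: nat set) f. valid_labelling G S f \<and> card S = USN G"
proof -
  have "\<exists>k. \<exists>(S :: nat set) f. valid_labelling G S f \<and> card S = k"
    using valid_labelling_nat_universe[OF valid_labelling_exists[OF assms]] by blast
  then show ?thesis unfolding USN_def by (rule LeastI_ex)
qed

end

theory Submission
  imports Defs
begin

text \<open>
  The universe has two elements for each binary digit position. The label of an endpoint of edge
  \<open>i\<close> picks one of the two in each position according to the digit of \<open>i\<close>, and the other endpoint
  gets the complement. Endpoints of different edges meet: at a position where the two indices
  differ if they lie on opposite sides, and at the leading position, where all digits are zero,
  if they lie on the same side.
\<close>

definition digit_label :: "nat \<Rightarrow> nat \<times> bool \<Rightarrow> (nat \<times> bool) set" where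
  "digit_label k v = (\<lambda>t. (t, bit (fst v) t = snd v)) ` {..k}"

text \<open>For each \<open>t \<le> k\<close> a label contains exactly one of
  \<open>(t, True)\<close> and \<open>(t, False)\<close>, so both disjointness and equality of
  labels can be decided position by position.\<close>

lemma digit_label_disjoint_iff:
  "digit_label k (i, b) \<inter> digit_label k (j, c) = {} \<longleftrightarrow> (\<forall>t\<le>k. (bit i t = b) \<noteq> (bit j t = c))"
  by (auto simp: digit_label_def)

lemma digit_label_eq_iff:
  "digit_label k (i, b) = digit_label k (j, c) \<longleftrightarrow> (\<forall>t\<le>k. (bit i t = b) = (bit j t = c))"
  by (auto simp: digit_label_def image_iff set_eq_iff)

lemma bit_nat_eq_False_if_less:
  fixes i :: nat
  assumes "i < 2 ^ k" and "k \<le> t"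
  shows "\<not> bit i t"
  using assms by (metis bit_take_bit_iff not_less take_bit_nat_eq_self)

text \<open>Beyond position \<open>k\<close> both numbers have only zero digits, so agreement up to
  \<open>k\<close> is agreement everywhere.\<close>

lemma nat_eq_if_low_bits_eq:
  fixes i j :: nat
  assumes "i < 2 ^ k" "j < 2 ^ k" and "\<And>t. t \<le> k \<Longrightarrow> bit i t = bit j t"
  shows "i = j"
  using assms bit_nat_eq_False_if_less by (metis bit_eqI nle_le)

lemma valid_labelling_digit_label:
  assumes "n \<le> 2 ^ k"
  shows "valid_labelling (matching_graph n) ({..k} \<times> UNIV) (digit_label k)"
proof -
  have lt: "i < 2 ^ k" if "i < n" for i
    using that assms by simp
  \<comment> \<open>Position \<open>k\<close> is the common leading zero: there the choice made by a
    label depends on the side \<open>b\<close> alone.\<close>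
  have top: "\<not> bit i k" if "i < n" for i
    using bit_nat_eq_False_if_less[OF lt[OF that]] by simp
  have low: "i = j" if "i < n" "j < n" "\<forall>t\<le>k. bit i t = bit j t" for i j
    using nat_eq_if_low_bits_eq lt that by blast
  have inj: "i = j \<and> b = c"
    if "i < n" "j < n" "digit_label k (i, b) = digit_label k (j, c)" for i j b c
  proof -
    have *: "(bit i t = b) = (bit j t = c)" if "t \<le> k" for t
      using \<open>digit_label k (i, b) = _\<close> that by (simp add: digit_label_eq_iff)
    \<comment> \<open>At \<open>t = k\<close> both digits are \<open>False\<close>, which leaves
      \<open>b = c\<close>; the sides then cancel in \<open>*\<close> at every other
      position.\<close>
    then have "b = c" using top that(1,2) by blast
    with * low[OF that(1,2)] show ?thesis by blast
  qed
  have adj: "((i, b), (j, c)) \<in> parcs (matching_graph n) \<longleftrightarrow>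
      digit_label k (i, b) \<inter> digit_label k (j, c) = {}" if "i < n" "j < n" for i j b c
  proof
    assume "((i, b), (j, c)) \<in> parcs (matching_graph n)"
    then show "digit_label k (i, b) \<inter> digit_label k (j, c) = {}"
      by (auto simp: matching_graph_def digit_label_disjoint_iff)
  next
    assume "digit_label k (i, b) \<inter> digit_label k (j, c) = {}"
    then have *: "(bit i t = b) \<noteq> (bit j t = c)" if "t \<le> k" for t
      using that by (simp add: digit_label_disjoint_iff)
    \<comment> \<open>Again \<open>t = k\<close> compares the sides only. With opposite sides,
      differing choices in \<open>*\<close> mean equal digits.\<close>
    then have "c = (\<not> b)" using top that by blast
    with * low[OF that] have "i = j" by blast
    with \<open>c = (\<not> b)\<close> show "((i, b), (j, c)) \<in> parcs (matching_graph n)"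
      using that by (auto simp: matching_graph_def)
  qed
  have verts: "pverts (matching_graph n) = {..<n} \<times> UNIV"
    by (simp add: matching_graph_def)
  have "inj_on (digit_label k) (pverts (matching_graph n))"
    unfolding verts inj_on_def using inj by blast
  moreover have "digit_label k v \<noteq> {} \<and> digit_label k v \<subseteq> {..k} \<times> UNIV" for v
    by (auto simp: digit_label_def)
  \<comment> \<open>This holds for \<open>u = v\<close> as well: there are no loops, and a nonempty
    label meets itself.\<close>
  moreover have "\<forall>u\<in>pverts (matching_graph n). \<forall>v\<in>pverts (matching_graph n).
      (u, v) \<in> parcs (matching_graph n) \<longleftrightarrow> digit_label k u \<inter> digit_label k v = {}"
    unfolding verts using adj by (simp add: Ball_def)
  ultimately show ?thesis
    by (simp add: valid_labelling_def)
qed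

lemma USN_matching_graph_le:
  assumes "n \<le> 2 ^ k"
  shows "USN (matching_graph n) \<le> 2 * (k + 1)"
  using USN_le_card[OF valid_labelling_digit_label[OF assms]]
  by (simp add: card_cartesian_product)

theorem theorem7:
  shows "\<exists>C > 0. \<exists>n0 \<ge> 1. \<forall>n \<ge> n0. real (USN (matching_graph n)) \<le> C * log 2 (2 * real n)"
proof -
  have "real (USN (matching_graph n)) \<le> 4 * log 2 (2 * real n)" if "n \<ge> 1" for n
  proof -
    define k where "k = nat \<lceil>log 2 (real n)\<rceil>"
    have pos: "0 \<le> log 2 (real n)" using that by simp
    have ge: "log 2 (real n) \<le> real k" and le: "real k \<le> log 2 (real n) + 1"
      using pos unfolding k_def by linarith+
    have "real n \<le> 2 powr real k"
      using ge that by (simp add: log_le_iff)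
    then have "n \<le> 2 ^ k"
      by (metis of_nat_le_iff of_nat_numeral of_nat_power powr_realpow zero_less_numeral)
    then have "real (USN (matching_graph n)) \<le> real (2 * (k + 1))"
      using USN_matching_graph_le of_nat_mono by blast
    \<comment> \<open>Rounding up gives \<open>2 * (k + 1) \<le> 2 * log 2 n + 4\<close>, and
      \<open>log 2 n \<ge> 0\<close> absorbs the rest. Hence the constant 4 works from
      \<open>n = 1\<close> on.\<close>
    also have "\<dots> \<le> 4 * (1 + log 2 (real n))"
      using le pos by simp
    also have "1 + log 2 (real n) = log 2 (2 * real n)"
      using that by (simp add: log_mult)
    finally show ?thesis .
  qed
  then show ?thesis
    by (intro exI[of _ 4] conjI exI[of _ "1 :: nat"]) auto
qed

end
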